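(* Let $\mathcal{S}$ be a topological (resp. étale) inverse semigroupoid. Then for every topological (resp. étale) groupoid $\mathcal{G}$ and every continuous semigroupoid homomorphism $\phi\colon\mathcal{G}\to\mathcal{S}$, the same map $\phi$, regarded as a map $\mathcal{G}\to\mathscr{U}(\mathcal{S})$, is a (continuous) groupoid homomorphism. In other words, there exists a unique continuous groupoid homomorphism $\psi\colon\mathcal{G}\to\mathscr{U}(\mathcal{S})$ (namely the same function as $\phi$) such that $\mathrm{id}\circ\psi=\phi$, where $\mathrm{id}\colon\mathscr{U}(\mathcal{S})\to\mathcal{S}$ is the identity map, regarded as a semigroupoid homomorphism.
   Context: A semigroupoid is a set $\Lambda$ with $\Lambda^{[2]}\subseteq\Lambda\times\Lambda$ and a product $\Lambda^{[2]}\to\Lambda$, $(f,g)\mapsto fg$, such that for all $f,g,h$ the statements (i) $(f,g),(g,h)\in\Lambda^{[2]}$; (ii) $(f,g),(fg,h)\in\Lambda^{[2]}$; (iii) $(g,h),(f,gh)\in\Lambda^{[2]}$ are equivalent, and then $(fg)h=f(gh)$. An inverse semigroupoid $\mathcal{S}$ is a semigroupoid in which each $a$ has a unique $a^*$ with $aa^*,a^*a$ defined, $aa^*a=a$, $a^*aa^*=a^*$. It carries a (unique up to relabelling vertices) graph structure: a set $\mathcal{S}^{(0)}$ and maps $\mathfrak{s},\mathfrak{r}\colon\mathcal{S}\to\mathcal{S}^{(0)}$ with $\mathcal{S}^{(0)}=\mathfrak{s}(\mathcal{S})\cup\mathfrak{r}(\mathcal{S})$, such that $ab$ is defined iff $\mathfrak{s}(a)=\mathfrak{r}(b)$,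 and then $\mathfrak{s}(ab)=\mathfrak{s}(b)$, $\mathfrak{r}(ab)=\mathfrak{r}(a)$. It is topological if $\mathcal{S}$ and $\mathcal{S}^{(0)}$ carry topologies making $\mathfrak{s},\mathfrak{r}$, the product (on $\mathcal{S}^{(2)}=\{(a,b):\mathfrak{s}(a)=\mathfrak{r}(b)\}$ with the topology induced from $\mathcal{S}\times\mathcal{S}$) and $a\mapsto a^*$ continuous; étale if moreover $\mathfrak{s}$ is a local homeomorphism. A semigroupoid homomorphism is a map $\phi$ such that if $ab$ is defined then $\phi(a)\phi(b)$ is defined and equals $\phi(ab)$. Topological (étale) groupoids, in the usual sense (unit space identified with the set of units, with the subspace topology), are topological (étale) inverse semigroupoids with $g^*=g^{-1}$. The underlying groupoid $\mathscr{U}(\mathcal{S})$ of an inverse semigroupoid $\mathcal{S}$ is the set $\mathcal{S}$ with the product restricted to $\{(a,b)\in\mathcal{S}\times\mathcal{S}:a^*a=bb^*\}$. It is a groupoid with unit space the set $E(\mathcal{S})$ of idempotents of $\mathcal{S}$, inverse $a^{-1}=a^*$, source $a\mapsto a^*a$ and range $a\mapsto aa^*$. If $\mathcal{S}$ is topological (resp. étale), $\mathscr{U}(\mathcal{S})$ has the same topology as $\mathcal{S}$, and is a topological (resp. étale) groupoid. *)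

theory Defs
  imports "HOL-Analysis.Analysis"
begin

section \<open>Semigroupoids\<close>

record 'a semigroupoid =
  arrows :: "'a set"
  composable :: "('a \<times> 'a) set"
  mul :: "'a \<Rightarrow> 'a \<Rightarrow> 'a"

definition semigroupoid :: "('a, 'm) semigroupoid_scheme \<Rightarrow> bool" where
  "semigroupoid S \<longleftrightarrow>
     composable S \<subseteq> arrows S \<times> arrows S \<and>
     (\<forall>(f, g) \<in> composable S. mul S f g \<in> arrows S) \<and>
     (\<forall>f\<in>arrows S. \<forall>g\<in>arrows S. \<forall>h\<in>arrows S.
        ((f, g) \<in> composable S \<and> (g, h) \<in> composable S \<longleftrightarrow>
         (f, g) \<in> composable S \<and> (mul S f g, h) \<in> composable S) \<and>
        ((f, g) \<in> composable S \<and> (g, h) \<in> composable S \<longleftrightarrow>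
         (g, h) \<in> composable S \<and> (f, mul S g h) \<in> composable S) \<and>
        ((f, g) \<in> composable S \<and> (g, h) \<in> composable S \<longrightarrow>
         mul S (mul S f g) h = mul S f (mul S g h)))"

definition is_generalized_inverse :: "('a, 'm) semigroupoid_scheme \<Rightarrow> 'a \<Rightarrow> 'a \<Rightarrow> bool" where
  "is_generalized_inverse S a b \<longleftrightarrow>
     b \<in> arrows S \<and> (a, b) \<in> composable S \<and> (b, a) \<in> composable S \<and>
     mul S (mul S a b) a = a \<and> mul S (mul S b a) b = b"

definition inverse_semigroupoid :: "('a, 'm) semigroupoid_scheme \<Rightarrow> bool" where
  "inverse_semigroupoid S \<longleftrightarrow>
     semigroupoid S \<and> (\<forall>a\<in>arrows S. \<exists>!b. is_generalized_inverse S a b)"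

definition star :: "('a, 'm) semigroupoid_scheme \<Rightarrow> 'a \<Rightarrow> 'a" where
  "star S a = (THE b. is_generalized_inverse S a b)"

definition idempotents :: "('a, 'm) semigroupoid_scheme \<Rightarrow> 'a set" where
  "idempotents S = {e \<in> arrows S. (e, e) \<in> composable S \<and> mul S e e = e}"

definition semigroupoid_hom ::
  "('a, 'm) semigroupoid_scheme \<Rightarrow> ('b, 'n) semigroupoid_scheme \<Rightarrow> ('a \<Rightarrow> 'b) \<Rightarrow> bool" where
  "semigroupoid_hom S T \<phi> \<longleftrightarrow>
     \<phi> \<in> arrows S \<rightarrow> arrows T \<and>
     (\<forall>(a, b) \<in> composable S.
        (\<phi> a, \<phi> b) \<in> composable T \<and> \<phi> (mul S a b) = mul T (\<phi> a) (\<phi> b))"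


section \<open>Graph structures and groupoids\<close>

record ('a, 'v) graphed_semigroupoid = "'a semigroupoid" +
  vertices :: "'v set"
  src :: "'a \<Rightarrow> 'v"
  rng :: "'a \<Rightarrow> 'v"

definition compatible_graph :: "('a, 'v, 'm) graphed_semigroupoid_scheme \<Rightarrow> bool" where
  "compatible_graph S \<longleftrightarrow>
     vertices S = src S ` arrows S \<union> rng S ` arrows S \<and>
     composable S = {(a, b) \<in> arrows S \<times> arrows S. src S a = rng S b} \<and>
     (\<forall>(a, b) \<in> composable S.
        src S (mul S a b) = src S b \<and> rng S (mul S a b) = rng S a)"

text \<open>
  A groupoid is a small category with all arrows invertible. Each object is identified with
  its identity arrow, so that the vertex set is a subset of the set of arrows.
\<close>

definition groupoid :: "('a, 'a, 'm) graphed_semigroupoid_scheme \<Rightarrow> bool" where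
  "groupoid G \<longleftrightarrow>
     vertices G \<subseteq> arrows G \<and>
     src G \<in> arrows G \<rightarrow> vertices G \<and>
     rng G \<in> arrows G \<rightarrow> vertices G \<and>
     composable G = {(a, b) \<in> arrows G \<times> arrows G. src G a = rng G b} \<and>
     (\<forall>(a, b) \<in> composable G.
        mul G a b \<in> arrows G \<and> src G (mul G a b) = src G b \<and> rng G (mul G a b) = rng G a) \<and>
     (\<forall>a b c. (a, b) \<in> composable G \<and> (b, c) \<in> composable G \<longrightarrow>
        mul G (mul G a b) c = mul G a (mul G b c)) \<and>
     (\<forall>x\<in>vertices G. src G x = x \<and> rng G x = x) \<and>
     (\<forall>a\<in>arrows G. mul G (rng G a) a = a \<and> mul G a (src G a) = a) \<and>
     (\<forall>a\<in>arrows G. \<exists>b\<in>arrows G. src G b = rng G a \<and> rng G b = src G a \<and>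
        mul G a b = rng G a \<and> mul G b a = src G a)"

text \<open>Groupoid homomorphisms are functors; units are preserved because vertices are arrows.\<close>

definition groupoid_hom ::
  "('a, 'a, 'm) graphed_semigroupoid_scheme \<Rightarrow> ('b, 'b, 'n) graphed_semigroupoid_scheme
     \<Rightarrow> ('a \<Rightarrow> 'b) \<Rightarrow> bool" where
  "groupoid_hom G H \<phi> \<longleftrightarrow>
     \<phi> \<in> arrows G \<rightarrow> arrows H \<and>
     (\<forall>a\<in>arrows G. src H (\<phi> a) = \<phi> (src G a) \<and> rng H (\<phi> a) = \<phi> (rng G a)) \<and>
     (\<forall>(a, b) \<in> composable G.
        (\<phi> a, \<phi> b) \<in> composable H \<and> \<phi> (mul G a b) = mul H (\<phi> a) (\<phi> b))"


section \<open>Topologies\<close>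

record ('a, 'v) top_semigroupoid = "('a, 'v) graphed_semigroupoid" +
  arrow_top :: "'a topology"
  vertex_top :: "'v topology"

definition local_homeomorphism :: "'a topology \<Rightarrow> 'b topology \<Rightarrow> ('a \<Rightarrow> 'b) \<Rightarrow> bool" where
  "local_homeomorphism X Y f \<longleftrightarrow>
     (\<forall>x\<in>topspace X. \<exists>U. openin X U \<and> x \<in> U \<and> openin Y (f ` U) \<and>
        homeomorphic_map (subtopology X U) (subtopology Y (f ` U)) f)"

definition topological_inverse_semigroupoid :: "('a, 'v, 'm) top_semigroupoid_scheme \<Rightarrow> bool" where
  "topological_inverse_semigroupoid S \<longleftrightarrow>
     inverse_semigroupoid S \<and> compatible_graph S \<and>
     topspace (arrow_top S) = arrows S \<and> topspace (vertex_top S) = vertices S \<and>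
     continuous_map (arrow_top S) (vertex_top S) (src S) \<and>
     continuous_map (arrow_top S) (vertex_top S) (rng S) \<and>
     continuous_map (subtopology (prod_topology (arrow_top S) (arrow_top S)) (composable S))
       (arrow_top S) (\<lambda>(a, b). mul S a b) \<and>
     continuous_map (arrow_top S) (arrow_top S) (star S)"

definition etale_inverse_semigroupoid :: "('a, 'v, 'm) top_semigroupoid_scheme \<Rightarrow> bool" where
  "etale_inverse_semigroupoid S \<longleftrightarrow>
     topological_inverse_semigroupoid S \<and>
     local_homeomorphism (arrow_top S) (vertex_top S) (src S)"

text \<open>
  In a groupoid, \<open>star\<close> is the inverse (lemma \<open>groupoid_star\<close> below), so the following is the
  usual notion of a topological groupoid.
\<close>

definition topological_groupoid :: "('a, 'a, 'm) top_semigroupoid_scheme \<Rightarrow> bool" where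
  "topological_groupoid G \<longleftrightarrow>
     groupoid G \<and> topological_inverse_semigroupoid G \<and>
     vertex_top G = subtopology (arrow_top G) (vertices G)"

definition etale_groupoid :: "('a, 'a, 'm) top_semigroupoid_scheme \<Rightarrow> bool" where
  "etale_groupoid G \<longleftrightarrow>
     topological_groupoid G \<and> local_homeomorphism (arrow_top G) (vertex_top G) (src G)"


section \<open>The underlying groupoid\<close>

definition underlying_groupoid ::
  "('a, 'v, 'm) top_semigroupoid_scheme \<Rightarrow> ('a, 'a) top_semigroupoid" where
  "underlying_groupoid S =
     \<lparr> arrows = arrows S,
       composable = {(a, b) \<in> arrows S \<times> arrows S. mul S (star S a) a = mul S b (star S b)},
       mul = mul S,
       vertices = idempotents S,
       src = (\<lambda>a. mul S (star S a) a),
       rng = (\<lambda>a. mul S a (star S a)),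
       arrow_top = arrow_top S,
       vertex_top = subtopology (arrow_top S) (idempotents S) \<rparr>"


section \<open>Consistency of the definitions\<close>

lemma star_eqI:
  assumes "inverse_semigroupoid S" "a \<in> arrows S" "is_generalized_inverse S a b"
  shows "star S a = b"
  using assms unfolding inverse_semigroupoid_def star_def by (metis the1_equality)

lemma star_props:
  assumes "inverse_semigroupoid S" "a \<in> arrows S"
  shows "is_generalized_inverse S a (star S a)"
  using assms unfolding inverse_semigroupoid_def star_def by (metis theI')

lemma groupoidD:
  assumes "groupoid G"
  shows "(x, y) \<in> composable G \<longleftrightarrow> x \<in> arrows G \<and> y \<in> arrows G \<and> src G x = rng G y"
    and "x \<in> arrows G \<Longrightarrow> y \<in> arrows G \<Longrightarrow> src G x = rng G y \<Longrightarrow>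
      mul G x y \<in> arrows G \<and> src G (mul G x y) = src G y \<and> rng G (mul G x y) = rng G x"
    and "x \<in> arrows G \<Longrightarrow> y \<in> arrows G \<Longrightarrow> z \<in> arrows G \<Longrightarrow> src G x = rng G y \<Longrightarrow> src G y = rng G z
      \<Longrightarrow> mul G (mul G x y) z = mul G x (mul G y z)"
    and "x \<in> arrows G \<Longrightarrow> mul G (rng G x) x = x \<and> mul G x (src G x) = x"
    and "x \<in> arrows G \<Longrightarrow> src G x \<in> vertices G \<and> rng G x \<in> vertices G"
    and "v \<in> vertices G \<Longrightarrow> v \<in> arrows G \<and> src G v = v \<and> rng G v = v"
    and "x \<in> arrows G \<Longrightarrow> \<exists>b\<in>arrows G. src G b = rng G x \<and> rng G b = src G x \<and>
        mul G x b = rng G x \<and> mul G b x = src G x"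
proof -
  show comp: "(x, y) \<in> composable G \<longleftrightarrow> x \<in> arrows G \<and> y \<in> arrows G \<and> src G x = rng G y" for x y
    using assms unfolding groupoid_def by auto
  show "mul G x y \<in> arrows G \<and> src G (mul G x y) = src G y \<and> rng G (mul G x y) = rng G x"
    if "x \<in> arrows G" "y \<in> arrows G" "src G x = rng G y"
    using assms comp[of x y] that unfolding groupoid_def by blast
  show "mul G (mul G x y) z = mul G x (mul G y z)"
    if "x \<in> arrows G" "y \<in> arrows G" "z \<in> arrows G" "src G x = rng G y" "src G y = rng G z"
    using assms comp[of x y] comp[of y z] that unfolding groupoid_def by blast
  show "v \<in> vertices G \<Longrightarrow> v \<in> arrows G \<and> src G v = v \<and> rng G v = v"
    using assms unfolding groupoid_def by blast
qed (use assms in \<open>unfold groupoid_def, blast+\<close>)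

lemma groupoid_generalized_inverse:
  assumes G: "groupoid G" and a: "a \<in> arrows G"
    and b: "b \<in> arrows G" "src G b = rng G a" "rng G b = src G a"
      "mul G a b = rng G a" "mul G b a = src G a"
  shows "is_generalized_inverse G a c \<longleftrightarrow> c = b"
proof
  note co = groupoidD(1)[OF G] and cl = groupoidD(2)[OF G] and assoc = groupoidD(3)[OF G]
    and un = groupoidD(4)[OF G]
  show "is_generalized_inverse G a c" if "c = b"
    using that a b un[of a] un[of b] unfolding is_generalized_inverse_def co by simp
  assume c: "is_generalized_inverse G a c"
  then have c': "c \<in> arrows G" "src G a = rng G c" "src G c = rng G a"
    "mul G (mul G a c) a = a" "mul G (mul G c a) c = c"
    unfolding is_generalized_inverse_def co by auto
  have "mul G a c = mul G (mul G a c) (mul G a b)"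
    using un[of "mul G a c"] cl[of a c] c' a b by simp
  also have "\<dots> = mul G (mul G (mul G a c) a) b"
    using assoc[of "mul G a c" a b] cl[of a c] c' a b by simp
  also have "\<dots> = rng G a" using c' b by simp
  finally have ac: "mul G a c = rng G a" .
  have "c = mul G (mul G b a) c" using un[of c] c' b by simp
  also have "\<dots> = mul G b (mul G a c)" using assoc[of b a c] c' a b by simp
  also have "\<dots> = b" using ac un[of b] b by simp
  finally show "c = b" .
qed

lemma groupoid_star:
  assumes G: "groupoid G"
  shows "inverse_semigroupoid G" "compatible_graph G"
    "a \<in> arrows G \<Longrightarrow> star G a \<in> arrows G \<and> mul G (star G a) a = src G a \<and> mul G a (star G a) = rng G a"
proof -
  note co = groupoidD(1)[OF G] and cl = groupoidD(2)[OF G] and assoc = groupoidD(3)[OF G]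
  show inv: "inverse_semigroupoid G"
    unfolding inverse_semigroupoid_def
  proof
    show "semigroupoid G"
      unfolding semigroupoid_def
    proof (intro conjI ballI)
      show "composable G \<subseteq> arrows G \<times> arrows G" using co by auto
      show "case p of (f, g) \<Rightarrow> mul G f g \<in> arrows G" if "p \<in> composable G" for p
        using that co cl by (cases p) blast
      fix f g h assume fgh: "f \<in> arrows G" "g \<in> arrows G" "h \<in> arrows G"
      show "(f, g) \<in> composable G \<and> (g, h) \<in> composable G \<longleftrightarrow>
          (f, g) \<in> composable G \<and> (mul G f g, h) \<in> composable G"
        unfolding co using fgh cl[of f g] by auto
      show "(f, g) \<in> composable G \<and> (g, h) \<in> composable G \<longleftrightarrow>
          (g, h) \<in> composable G \<and> (f, mul G g h) \<in> composable G"
        unfolding co using fgh cl[of g h] by auto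
      show "(f, g) \<in> composable G \<and> (g, h) \<in> composable G \<longrightarrow>
          mul G (mul G f g) h = mul G f (mul G g h)"
        unfolding co using assoc[of f g h] by blast
    qed
    show "\<forall>a\<in>arrows G. \<exists>!b. is_generalized_inverse G a b"
    proof
      fix a assume a: "a \<in> arrows G"
      obtain b where "b \<in> arrows G" "src G b = rng G a" "rng G b = src G a"
        "mul G a b = rng G a" "mul G b a = src G a" using groupoidD(7)[OF G a] by blast
      with groupoid_generalized_inverse[OF G a] show "\<exists>!b. is_generalized_inverse G a b" by metis
    qed
  qed
  show "compatible_graph G"
    unfolding compatible_graph_def
  proof (intro conjI)
    show "vertices G = src G ` arrows G \<union> rng G ` arrows G"
      using groupoidD(5,6)[OF G] by force
    show "composable G = {(a, b) \<in> arrows G \<times> arrows G. src G a = rng G b}"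
      using co by auto
    show "\<forall>(a, b)\<in>composable G. src G (mul G a b) = src G b \<and> rng G (mul G a b) = rng G a"
      using co cl by blast
  qed
  show "star G a \<in> arrows G \<and> mul G (star G a) a = src G a \<and> mul G a (star G a) = rng G a"
    if a: "a \<in> arrows G"
  proof -
    obtain b where b: "b \<in> arrows G" "src G b = rng G a" "rng G b = src G a"
      "mul G a b = rng G a" "mul G b a = src G a" using groupoidD(7)[OF G a] by blast
    have "star G a = b"
      using groupoid_generalized_inverse[OF G a b] star_props[OF inv a] by simp
    then show ?thesis using b by simp
  qed
qed

lemma semigroupoid_hom_id_underlying:
  assumes "topological_inverse_semigroupoid S"
  shows "semigroupoid_hom (underlying_groupoid S) S id"
proof -
  have "(a, b) \<in> composable S"
    if ab: "a \<in> arrows S" "b \<in> arrows S" "mul S (star S a) a = mul S b (star S b)" for a b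
  proof -
    have I: "inverse_semigroupoid S" and C: "compatible_graph S"
      using assms by (simp_all add: topological_inverse_semigroupoid_def)
    have co: "(x, y) \<in> composable S \<longleftrightarrow> x \<in> arrows S \<and> y \<in> arrows S \<and> src S x = rng S y" for x y
      using C unfolding compatible_graph_def by blast
    have sr: "src S (mul S x y) = src S y" "rng S (mul S x y) = rng S x"
      if "(x, y) \<in> composable S" for x y
      using C that unfolding compatible_graph_def by blast+
    have "(star S a, a) \<in> composable S" "(b, star S b) \<in> composable S"
      using star_props[OF I ab(1)] star_props[OF I ab(2)]
      by (simp_all add: is_generalized_inverse_def)
    then have "src S (mul S (star S a) a) = src S a" "src S (mul S b (star S b)) = rng S b"
      using sr[of "star S a" a] sr[of b "star S b"] co[of b "star S b"]
        star_props[OF I ab(2)] by (simp_all add: is_generalized_inverse_def co)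
    then show ?thesis using ab unfolding co by simp
  qed
  then show ?thesis
    by (auto simp: semigroupoid_hom_def underlying_groupoid_def)
qed

lemma underlying_groupoid_groupoid:
  assumes "inverse_semigroupoid S" and C: "compatible_graph S"
  shows "groupoid (underlying_groupoid S)"
    and "a \<in> arrows S \<Longrightarrow> star (underlying_groupoid S) a = star S a"
proof -
  have I: "inverse_semigroupoid S" by fact
  let ?i = "star S" and ?m = "mul S"
  have co: "(x, y) \<in> composable S \<longleftrightarrow> x \<in> arrows S \<and> y \<in> arrows S \<and> src S x = rng S y" for x y
    using C unfolding compatible_graph_def by auto
  have sr: "src S (?m x y) = src S y" "rng S (?m x y) = rng S x"
    if "x \<in> arrows S" "y \<in> arrows S" "src S x = rng S y" for x y
    using C that unfolding compatible_graph_def by auto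
  have cl: "?m x y \<in> arrows S" if "x \<in> arrows S" "y \<in> arrows S" "src S x = rng S y" for x y
    using I that co[of x y] unfolding inverse_semigroupoid_def semigroupoid_def by auto
  have as: "?m (?m x y) z = ?m x (?m y z)"
    if "x \<in> arrows S" "y \<in> arrows S" "z \<in> arrows S" "src S x = rng S y" "src S y = rng S z" for x y z
    using I that co[of x y] co[of y z] unfolding inverse_semigroupoid_def semigroupoid_def by blast
  have st: "?i a \<in> arrows S" "src S a = rng S (?i a)" "src S (?i a) = rng S a"
    "?m (?m a (?i a)) a = a" "?m (?m (?i a) a) (?i a) = ?i a" if "a \<in> arrows S" for a
    using star_props[OF I that] co unfolding is_generalized_inverse_def by auto
  have stI: "?i a = b" if "a \<in> arrows S" "b \<in> arrows S" "src S a = rng S b" "src S b = rng S a"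
    "?m (?m a b) a = a" "?m (?m b a) b = b" for a b
    using star_eqI[OF I that(1)] that co unfolding is_generalized_inverse_def by auto
  have ii: "?i (?i a) = a" if "a \<in> arrows S" for a
    using stI[of "?i a" a] st[OF that] that by auto
  have e1: "?m (?i a) a \<in> idempotents S" "?m a (?i a) \<in> idempotents S" if "a \<in> arrows S" for a
    using st[OF that] that cl[of a "?i a"] cl[of "?i a" a] sr[of a "?i a"] sr[of "?i a" a]
      as[of "?m (?i a) a" "?i a" a] as[of "?m a (?i a)" a "?i a"]
    unfolding idempotents_def by (auto simp: co)
  have e2: "?i e = e \<and> ?m e e = e \<and> e \<in> arrows S" if "e \<in> idempotents S" for e
    using that stI[of e e] unfolding idempotents_def by (auto simp: co)
  have gr: "?m (?i (?m a b)) (?m a b) = ?m (?i b) b \<and>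
      ?m (?m a b) (?i (?m a b)) = ?m a (?i a) \<and> src S a = rng S b"
    if ab: "a \<in> arrows S" "b \<in> arrows S" "?m (?i a) a = ?m b (?i b)" for a b
  proof -
    note s = st[OF ab(1)] st[OF ab(2)]
    have sab: "src S a = rng S b"
      using sr[of "?i a" a] sr[of b "?i b"] s ab by simp
    have bb: "?m b (?m (?i b) (?i a)) = ?i a"
      using as[of b "?i b" "?i a"] s ab sab by simp
    have aa: "?m (?i a) (?m a b) = b"
      using as[of "?i a" a b] s ab sab by simp
    have 1: "?m (?m a b) (?m (?i b) (?i a)) = ?m a (?i a)"
      using as[of a b "?m (?i b) (?i a)"] cl[of "?i b" "?i a"] sr[of "?i b" "?i a"] bb s ab sab by simp
    have 2: "?m (?m (?i b) (?i a)) (?m a b) = ?m (?i b) b"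
      using as[of "?i b" "?i a" "?m a b"] cl[of a b] sr[of a b] aa s ab sab by simp
    have 3: "?m (?m a (?i a)) (?m a b) = ?m a b"
      using as[of "?m a (?i a)" a b] cl[of a "?i a"] sr[of a "?i a"] s ab sab by simp
    have 4: "?m (?m (?i b) b) (?m (?i b) (?i a)) = ?m (?i b) (?i a)"
      using as[of "?m (?i b) b" "?i b" "?i a"] cl[of "?i b" b] sr[of "?i b" b] s ab sab by simp
    have "?i (?m a b) = ?m (?i b) (?i a)"
      using stI[of "?m a b" "?m (?i b) (?i a)"] 1 2 3 4 s ab sab
        cl[of a b] sr[of a b] cl[of "?i b" "?i a"] sr[of "?i b" "?i a"] by simp
    with 1 2 sab show ?thesis by simp
  qed
  let ?U = "underlying_groupoid S"
  note U = underlying_groupoid_def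
  have ma: "?m a (?m (?i a) a) = a" if "a \<in> arrows S" for a
    using as[of a "?i a" a] st[OF that] that by simp
  show G: "groupoid ?U"
    unfolding groupoid_def
  proof (intro conjI)
    show "vertices ?U \<subseteq> arrows ?U" by (auto simp: U idempotents_def)
    show "src ?U \<in> arrows ?U \<rightarrow> vertices ?U" "rng ?U \<in> arrows ?U \<rightarrow> vertices ?U"
      using e1 by (auto simp: U)
    show "composable ?U = {(a, b) \<in> arrows ?U \<times> arrows ?U. src ?U a = rng ?U b}"
      by (auto simp: U)
    show "\<forall>(a, b) \<in> composable ?U. mul ?U a b \<in> arrows ?U \<and>
        src ?U (mul ?U a b) = src ?U b \<and> rng ?U (mul ?U a b) = rng ?U a"
      using gr cl by (auto simp: U)
    show "\<forall>a b c. (a, b) \<in> composable ?U \<and> (b, c) \<in> composable ?U \<longrightarrow>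
        mul ?U (mul ?U a b) c = mul ?U a (mul ?U b c)"
      using gr as by (auto simp: U)
    show "\<forall>x\<in>vertices ?U. src ?U x = x \<and> rng ?U x = x"
      using e2 by (auto simp: U)
    show "\<forall>a\<in>arrows ?U. mul ?U (rng ?U a) a = a \<and> mul ?U a (src ?U a) = a"
      using st ma by (auto simp: U)
    show "\<forall>a\<in>arrows ?U. \<exists>b\<in>arrows ?U. src ?U b = rng ?U a \<and> rng ?U b = src ?U a \<and>
        mul ?U a b = rng ?U a \<and> mul ?U b a = src ?U a"
    proof
      fix a assume "a \<in> arrows ?U"
      then have "?i a \<in> arrows S" "?i (?i a) = a" using st ii by (auto simp: U)
      then show "\<exists>b\<in>arrows ?U. src ?U b = rng ?U a \<and> rng ?U b = src ?U a \<and>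
        mul ?U a b = rng ?U a \<and> mul ?U b a = src ?U a"
        by (intro bexI[of _ "?i a"]) (auto simp: U)
    qed
  qed
  show "star ?U a = ?i a" if a: "a \<in> arrows S"
  proof (rule star_eqI[OF groupoid_star(1)[OF G]])
    show "a \<in> arrows ?U" using a by (simp add: U)
    show "is_generalized_inverse ?U a (?i a)"
      using a st[OF a] ii[OF a] by (auto simp: U is_generalized_inverse_def)
  qed
qed

lemma underlying_groupoid_topological:
  assumes S: "topological_inverse_semigroupoid S"
  shows "topological_groupoid (underlying_groupoid S)"
proof -
  let ?U = "underlying_groupoid S" and ?T = "arrow_top S"
  let ?P = "subtopology (prod_topology ?T ?T) (composable S)"
  note U = underlying_groupoid_def
  have I: "inverse_semigroupoid S" and C: "compatible_graph S" and tT: "topspace ?T = arrows S"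
    and m: "continuous_map ?P ?T (\<lambda>(a, b). mul S a b)" and i: "continuous_map ?T ?T (star S)"
    using S by (auto simp: topological_inverse_semigroupoid_def)
  note G = underlying_groupoid_groupoid(1)[OF I C]
  have ci: "(a, star S a) \<in> composable S" "(star S a, a) \<in> composable S" if "a \<in> arrows S" for a
    using star_props[OF I that] by (auto simp: is_generalized_inverse_def)
  have "continuous_map ?T ?P (\<lambda>a. (star S a, a))" "continuous_map ?T ?P (\<lambda>a. (a, star S a))"
    using ci i tT by (auto simp: continuous_map_in_subtopology continuous_map_pairedI Pi_iff)
  from this[THEN continuous_map_compose, OF m]
  have sr: "continuous_map ?T ?T (\<lambda>a. mul S (star S a) a)" "continuous_map ?T ?T (\<lambda>a. mul S a (star S a))"
    by (simp_all add: o_def)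
  have sub: "composable ?U \<subseteq> composable S"
    using semigroupoid_hom_id_underlying[OF S] by (auto simp: semigroupoid_hom_def)
  have V: "vertices ?U \<subseteq> arrows S" "src ?U \<in> arrows S \<rightarrow> vertices ?U" "rng ?U \<in> arrows S \<rightarrow> vertices ?U"
    using G unfolding groupoid_def by (auto simp: U)
  have "topological_inverse_semigroupoid ?U"
    unfolding topological_inverse_semigroupoid_def
  proof (intro conjI)
    show "inverse_semigroupoid ?U" "compatible_graph ?U" using groupoid_star[OF G] by auto
    show "topspace (arrow_top ?U) = arrows ?U" by (simp add: U tT)
    show "topspace (vertex_top ?U) = vertices ?U" using V tT by (auto simp: U)
    show "continuous_map (arrow_top ?U) (vertex_top ?U) (src ?U)"
      "continuous_map (arrow_top ?U) (vertex_top ?U) (rng ?U)"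
      using sr V tT by (auto simp: U continuous_map_in_subtopology Pi_iff)
    show "continuous_map (subtopology (prod_topology (arrow_top ?U) (arrow_top ?U)) (composable ?U))
       (arrow_top ?U) (\<lambda>(a, b). mul ?U a b)"
      using continuous_map_from_subtopology_mono[OF m sub] by (simp add: U)
    have "continuous_map ?T ?T (star ?U)"
      by (rule continuous_map_eq[OF i]) (simp add: tT underlying_groupoid_groupoid(2)[OF I C])
    then show "continuous_map (arrow_top ?U) (arrow_top ?U) (star ?U)" by (simp add: U)
  qed
  then show ?thesis using G by (simp add: topological_groupoid_def U)
qed

lemma underlying_groupoid_etale:
  assumes S: "etale_inverse_semigroupoid S"
  shows "etale_groupoid (underlying_groupoid S)"
proof -
  let ?U = "underlying_groupoid S" and ?T = "arrow_top S" and ?V = "vertex_top S"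
  let ?s = "src S" and ?p = "src (underlying_groupoid S)" and ?E = "idempotents S"
  note U = underlying_groupoid_def
  have tS: "topological_inverse_semigroupoid S" and lh: "local_homeomorphism ?T ?V ?s"
    using S by (simp_all add: etale_inverse_semigroupoid_def)
  have I: "inverse_semigroupoid S" and C: "compatible_graph S" and tT: "topspace ?T = arrows S"
    and cs: "continuous_map ?T ?V ?s"
    using tS by (auto simp: topological_inverse_semigroupoid_def)
  have tU: "topological_groupoid ?U" by (rule underlying_groupoid_topological[OF tS])
  have cp: "continuous_map ?T (subtopology ?T ?E) ?p"
    using tU by (simp add: topological_groupoid_def topological_inverse_semigroupoid_def U)
  then have cpT: "continuous_map ?T ?T ?p" and pE: "\<And>a. a \<in> arrows S \<Longrightarrow> ?p a \<in> ?E"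
    by (auto simp: continuous_map_in_subtopology tT Pi_iff)
  have sp: "?s (?p a) = ?s a" if "a \<in> arrows S" for a
    using star_props[OF I that] C
    unfolding is_generalized_inverse_def compatible_graph_def by (auto simp: U)
  have nb: "\<exists>W. openin ?T W \<and> a \<in> W \<and> inj_on ?s W \<and> (\<forall>W'\<subseteq>W. openin ?T W' \<longrightarrow> openin ?V (?s ` W'))"
    if a: "a \<in> arrows S" for a
  proof -
    obtain W where W: "openin ?T W" "a \<in> W" "openin ?V (?s ` W)"
      and h: "homeomorphic_map (subtopology ?T W) (subtopology ?V (?s ` W)) ?s"
      using lh[unfolded local_homeomorphism_def tT, THEN bspec, OF a] by blast
    have tW: "topspace (subtopology ?T W) = W" using W(1) openin_subset by auto
    have "inj_on ?s W" using homeomorphic_imp_injective_map[OF h] tW by simp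
    moreover have "openin ?V (?s ` W')" if "W' \<subseteq> W" "openin ?T W'" for W'
    proof -
      have "openin (subtopology ?T W) W'"
        using that W(1) by (simp add: openin_open_subtopology)
      then have "openin (subtopology ?V (?s ` W)) (?s ` W')"
        using homeomorphic_imp_open_map[OF h] by (simp add: open_map_def)
      then show ?thesis using W(3) by (simp add: openin_open_subtopology)
    qed
    ultimately show ?thesis using W by blast
  qed
  have "local_homeomorphism ?T (subtopology ?T ?E) ?p"
    unfolding local_homeomorphism_def
  proof
    fix a assume "a \<in> topspace ?T"
    then have a: "a \<in> arrows S" using tT by simp
    obtain A where A: "openin ?T A" "a \<in> A" "inj_on ?s A"
      "\<And>W'. W' \<subseteq> A \<Longrightarrow> openin ?T W' \<Longrightarrow> openin ?V (?s ` W')"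
      using nb[OF a] by blast
    have pa: "?p a \<in> arrows S" using pE[OF a] by (simp add: idempotents_def)
    obtain B where B: "openin ?T B" "?p a \<in> B" "inj_on ?s B"
      using nb[OF pa] by blast
    define W where "W = A \<inter> {b \<in> topspace ?T. ?p b \<in> B}"
    have Wo: "openin ?T W"
      unfolding W_def using A(1) openin_continuous_map_preimage[OF cpT B(1)] by blast
    have Wa: "W \<subseteq> arrows S" using tT by (auto simp: W_def)
    have op: "openin (subtopology ?T ?E) (?p ` W')" if "W' \<subseteq> W" "openin ?T W'" for W'
    proof -
      have "openin ?V (?s ` W')" using A(4)[of W'] that by (auto simp: W_def)
      then have o: "openin ?T (B \<inter> {v \<in> topspace ?T. ?s v \<in> ?s ` W'})"
        using B(1) openin_continuous_map_preimage[OF cs] by blast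
      have "?p ` W' = B \<inter> {v \<in> topspace ?T. ?s v \<in> ?s ` W'}"
      proof (intro equalityI subsetI)
        fix v assume "v \<in> ?p ` W'"
        then obtain b where b: "b \<in> W'" "v = ?p b" by blast
        then have "b \<in> arrows S" "?p b \<in> B" using that Wa by (auto simp: W_def)
        then show "v \<in> B \<inter> {v \<in> topspace ?T. ?s v \<in> ?s ` W'}"
          using b sp[of b] pE[of b] tT by (auto simp: idempotents_def)
      next
        fix v assume v: "v \<in> B \<inter> {v \<in> topspace ?T. ?s v \<in> ?s ` W'}"
        then obtain b where b: "b \<in> W'" "?s v = ?s b" by blast
        then have "b \<in> arrows S" "?p b \<in> B" using that Wa by (auto simp: W_def)
        then have "v = ?p b" using v b sp[of b] inj_onD[OF B(3), of v "?p b"] by simp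
        then show "v \<in> ?p ` W'" using b by blast
      qed
      then have "openin ?T (?p ` W')" using o by simp
      moreover have "?p ` W' \<subseteq> ?E" using pE that Wa by blast
      ultimately show ?thesis unfolding openin_subtopology by blast
    qed
    have pW: "openin (subtopology ?T ?E) (?p ` W)" using op Wo by blast
    have tW: "topspace (subtopology ?T W) = W" using Wa tT by auto
    have tpW: "topspace (subtopology (subtopology ?T ?E) (?p ` W)) = ?p ` W"
      using openin_subset[OF pW] by auto
    have "homeomorphic_map (subtopology ?T W) (subtopology (subtopology ?T ?E) (?p ` W)) ?p"
    proof (rule bijective_open_imp_homeomorphic_map)
      show "continuous_map (subtopology ?T W) (subtopology (subtopology ?T ?E) (?p ` W)) ?p"
        using continuous_map_from_subtopology[OF cp, of W] tW
        by (auto simp: continuous_map_in_subtopology)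
      show "open_map (subtopology ?T W) (subtopology (subtopology ?T ?E) (?p ` W)) ?p"
        using op Wo pW by (auto simp: open_map_def openin_open_subtopology)
      show "?p ` topspace (subtopology ?T W) = topspace (subtopology (subtopology ?T ?E) (?p ` W))"
        by (simp only: tW tpW)
      have "inj_on ?p W"
      proof (rule inj_onI)
        fix x y assume xy: "x \<in> W" "y \<in> W" "?p x = ?p y"
        then have "?s x = ?s y" using sp Wa by (metis subsetD)
        then show "x = y" using xy A(3) by (auto simp: W_def inj_on_def)
      qed
      then show "inj_on ?p (topspace (subtopology ?T W))" by (simp only: tW)
    qed
    moreover have "a \<in> W" using A(2) B(2) a tT by (simp add: W_def)
    ultimately show "\<exists>W. openin ?T W \<and> a \<in> W \<and> openin (subtopology ?T ?E) (?p ` W) \<and>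
        homeomorphic_map (subtopology ?T W) (subtopology (subtopology ?T ?E) (?p ` W)) ?p"
      using Wo pW by blast
  qed
  moreover have "arrow_top ?U = ?T" "vertex_top ?U = subtopology ?T ?E" by (simp_all add: U)
  ultimately show ?thesis using tU by (simp add: etale_groupoid_def)
qed

end

theory Submission
  imports Defs
begin

text \<open>
  A semigroupoid homomorphism only sees products, so it carries a generalized inverse of \<open>a\<close> to a
  generalized inverse of \<open>\<phi> a\<close>; as inverses in an inverse semigroupoid are unique, it commutes with
  \<open>star\<close> (lemma \<open>semigroupoid_hom_star\<close>). In a groupoid the source and the range of \<open>a\<close> are the units
  \<open>a\<^sup>*a\<close> and \<open>aa\<^sup>*\<close>, and the underlying groupoid of \<open>S\<close> takes exactly these expressions as its source
  and range. Hence \<open>\<phi>\<close> intertwines the sources and ranges of \<open>G\<close> with those of the underlying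
  groupoid: two arrows that meet in \<open>G\<close> have images that are composable not only in \<open>S\<close> but under
  the stricter condition of the underlying groupoid, and \<open>\<phi>\<close> is a functor
  (lemma \<open>semigroupoid_hom_imp_groupoid_hom_underlying\<close>).

  Continuity is unchanged because the two arrow spaces coincide. The etale case is an instance of
  the topological one. Since \<open>\<phi>\<close> is a total function with arbitrary values off the arrows of \<open>G\<close>,
  its restriction to these arrows is the extensional function that witnesses the unique
  factorization.
\<close>

text \<open>
  Associativity supplies what the definition of a homomorphism needs here: if \<open>ab\<close> and \<open>ba\<close> are
  defined then so is \<open>(ab)a\<close>, hence the triple products are transported too.
\<close>

lemma semigroupoid_hom_generalized_inverse:
  assumes S: "semigroupoid S" and hom: "semigroupoid_hom S T \<phi>"
    and a: "a \<in> arrows S" and b: "is_generalized_inverse S a b"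
  shows "is_generalized_inverse T (\<phi> a) (\<phi> b)"
proof -
  have b': "b \<in> arrows S" "(a, b) \<in> composable S" "(b, a) \<in> composable S"
    "mul S (mul S a b) a = a" "mul S (mul S b a) b = b"
    using b unfolding is_generalized_inverse_def by auto
  have aba: "(mul S a b, a) \<in> composable S" "(mul S b a, b) \<in> composable S"
    using S a b' unfolding semigroupoid_def by blast+
  have h: "(\<phi> x, \<phi> y) \<in> composable T" "mul T (\<phi> x) (\<phi> y) = \<phi> (mul S x y)"
    if "(x, y) \<in> composable S" for x y
    using hom that unfolding semigroupoid_hom_def by auto
  have "\<phi> b \<in> arrows T"
    using hom b' unfolding semigroupoid_hom_def by blast
  then show ?thesis
    unfolding is_generalized_inverse_def by (simp add: h b' aba)
qed

lemma semigroupoid_hom_star: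
  assumes S: "inverse_semigroupoid S" and T: "inverse_semigroupoid T"
    and hom: "semigroupoid_hom S T \<phi>" and a: "a \<in> arrows S"
  shows "star T (\<phi> a) = \<phi> (star S a)"
proof (rule star_eqI[OF T])
  show "\<phi> a \<in> arrows T"
    using hom a unfolding semigroupoid_hom_def by blast
  show "is_generalized_inverse T (\<phi> a) (\<phi> (star S a))"
    using S star_props[OF S a] semigroupoid_hom_generalized_inverse[OF _ hom a]
    unfolding inverse_semigroupoid_def by blast
qed

text \<open>
  This is the algebraic content of the universal property: \<open>\<phi>\<close> sends \<open>a\<^sup>*a\<close> to \<open>(\<phi> a)\<^sup>*(\<phi> a)\<close>, and
  the equality of these elements is the composability condition of the underlying groupoid.
\<close>

lemma semigroupoid_hom_imp_groupoid_hom_underlying: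
  assumes G: "groupoid G" and S: "inverse_semigroupoid S" and hom: "semigroupoid_hom G S \<phi>"
  shows "groupoid_hom G (underlying_groupoid S) \<phi>"
proof -
  let ?U = "underlying_groupoid S"
  note star = groupoid_star(3)[OF G] and inv = groupoid_star(1)[OF G]
  have ar: "\<phi> a \<in> arrows S" if "a \<in> arrows G" for a
    using hom that unfolding semigroupoid_hom_def by blast
  have mul: "\<phi> (mul G x y) = mul S (\<phi> x) (\<phi> y)" if "(x, y) \<in> composable G" for x y
    using hom that unfolding semigroupoid_hom_def by blast
  have sr: "src ?U (\<phi> a) = \<phi> (src G a)" "rng ?U (\<phi> a) = \<phi> (rng G a)" if a: "a \<in> arrows G" for a
  proof -
    have c: "(star G a, a) \<in> composable G" "(a, star G a) \<in> composable G"
      using star_props[OF inv a] unfolding is_generalized_inverse_def by auto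
    show "src ?U (\<phi> a) = \<phi> (src G a)" "rng ?U (\<phi> a) = \<phi> (rng G a)"
      using mul[OF c(1)] mul[OF c(2)] star[OF a] semigroupoid_hom_star[OF inv S hom a]
      by (simp_all add: underlying_groupoid_def)
  qed
  have comp: "(\<phi> a, \<phi> b) \<in> composable ?U" if "(a, b) \<in> composable G" for a b
  proof -
    have ab: "a \<in> arrows G" "b \<in> arrows G" "src G a = rng G b"
      using that groupoidD(1)[OF G] by auto
    then have "src ?U (\<phi> a) = rng ?U (\<phi> b)" using sr by simp
    then show ?thesis using ar ab by (simp add: underlying_groupoid_def)
  qed
  show ?thesis
    unfolding groupoid_hom_def using ar sr comp mul by (auto simp: underlying_groupoid_def)
qed

lemma groupoid_hom_cong:
  assumes G: "groupoid G" and eq: "\<And>a. a \<in> arrows G \<Longrightarrow> \<phi> a = \<psi> a"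
    and hom: "groupoid_hom G H \<phi>"
  shows "groupoid_hom G H \<psi>"
proof -
  have eq': "\<psi> a = \<phi> a" if "a \<in> arrows G" for a
    using eq[OF that] by simp
  have units: "src G a \<in> arrows G" "rng G a \<in> arrows G" if "a \<in> arrows G" for a
    using groupoidD(5)[OF G that] groupoidD(6)[OF G] by auto
  have "a \<in> arrows G" "b \<in> arrows G" "mul G a b \<in> arrows G" if "(a, b) \<in> composable G" for a b
    using that groupoidD(1)[OF G, of a b] groupoidD(2)[OF G, of a b] by auto
  then show ?thesis
    using hom units unfolding groupoid_hom_def by (fastforce simp: eq' Pi_iff)
qed

lemma underlying_groupoid_universal:
  assumes S: "topological_inverse_semigroupoid S" and G: "topological_groupoid G"
    and hom: "semigroupoid_hom G S \<phi>" and cont: "continuous_map (arrow_top G) (arrow_top S) \<phi>"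
  shows "groupoid_hom G (underlying_groupoid S) \<phi>"
    and "continuous_map (arrow_top G) (arrow_top (underlying_groupoid S)) \<phi>"
    and "\<exists>!\<psi>. \<psi> \<in> extensional (arrows G) \<and>
           groupoid_hom G (underlying_groupoid S) \<psi> \<and>
           continuous_map (arrow_top G) (arrow_top (underlying_groupoid S)) \<psi> \<and>
           (\<forall>g\<in>arrows G. (id \<circ> \<psi>) g = \<phi> g)"
proof -
  let ?U = "underlying_groupoid S"
  have gr: "groupoid G" and tG: "topspace (arrow_top G) = arrows G"
    using G unfolding topological_groupoid_def topological_inverse_semigroupoid_def by auto
  have I: "inverse_semigroupoid S"
    using S unfolding topological_inverse_semigroupoid_def by blast
  show h: "groupoid_hom G ?U \<phi>"
    by (rule semigroupoid_hom_imp_groupoid_hom_underlying[OF gr I hom])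
  show c: "continuous_map (arrow_top G) (arrow_top ?U) \<phi>"
    using cont by (simp add: underlying_groupoid_def)
  show "\<exists>!\<psi>. \<psi> \<in> extensional (arrows G) \<and> groupoid_hom G ?U \<psi> \<and>
      continuous_map (arrow_top G) (arrow_top ?U) \<psi> \<and> (\<forall>g\<in>arrows G. (id \<circ> \<psi>) g = \<phi> g)"
  proof (rule ex1I[of _ "restrict \<phi> (arrows G)"], intro conjI)
    show "groupoid_hom G ?U (restrict \<phi> (arrows G))"
      by (rule groupoid_hom_cong[OF gr _ h]) simp
    show "continuous_map (arrow_top G) (arrow_top ?U) (restrict \<phi> (arrows G))"
      by (rule continuous_map_eq[OF c]) (simp add: tG)
  qed (auto intro!: extensionalityI[of _ "arrows G"])
qed

theorem proposition4p2:
  fixes S :: "('a, 'v) top_semigroupoid"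
    and G :: "('g, 'g) top_semigroupoid"
    and \<phi> :: "'g \<Rightarrow> 'a"
  shows
    "(topological_inverse_semigroupoid S \<and> topological_groupoid G \<and>
      semigroupoid_hom G S \<phi> \<and> continuous_map (arrow_top G) (arrow_top S) \<phi> \<longrightarrow>
        groupoid_hom G (underlying_groupoid S) \<phi> \<and>
        continuous_map (arrow_top G) (arrow_top (underlying_groupoid S)) \<phi> \<and>
        (\<exists>!\<psi>. \<psi> \<in> extensional (arrows G) \<and>
           groupoid_hom G (underlying_groupoid S) \<psi> \<and>
           continuous_map (arrow_top G) (arrow_top (underlying_groupoid S)) \<psi> \<and>
           (\<forall>g\<in>arrows G. (id \<circ> \<psi>) g = \<phi> g))) \<and>
     (etale_inverse_semigroupoid S \<and> etale_groupoid G \<and>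
      semigroupoid_hom G S \<phi> \<and> continuous_map (arrow_top G) (arrow_top S) \<phi> \<longrightarrow>
        groupoid_hom G (underlying_groupoid S) \<phi> \<and>
        continuous_map (arrow_top G) (arrow_top (underlying_groupoid S)) \<phi> \<and>
        (\<exists>!\<psi>. \<psi> \<in> extensional (arrows G) \<and>
           groupoid_hom G (underlying_groupoid S) \<psi> \<and>
           continuous_map (arrow_top G) (arrow_top (underlying_groupoid S)) \<psi> \<and>
           (\<forall>g\<in>arrows G. (id \<circ> \<psi>) g = \<phi> g)))"
  using underlying_groupoid_universal[of S G \<phi>]
  unfolding etale_inverse_semigroupoid_def etale_groupoid_def by blast

end
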